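(* Let $X$ be a set and $M$ a full inverse submonoid of $I_X$. Then the following are equivalent: (i) $M$ is closed in the topology $\mathcal{I}_1$; (ii) $M$ is closed in the topology $\mathcal{I}_4$; (iii) there exists a relational structure $\mathcal{R} = (X, \mathbf{R})$ such that $M = \operatorname{pAut}(\mathcal{R})$.
   Context: For a set $X$, $I_X$ is the symmetric inverse monoid: the set of all bijections between subsets of $X$ (partial bijections, called charts) under composition of partial functions, written left to right (the image of $x$ under $f$ is $xf$). $E_X$ is the set of all idempotents of $I_X$, i.e. all partial identities (identity maps on subsets of $X$). A submonoid $M$ of $I_X$ is full if $E_X \subseteq M$, and inverse if it is closed under $f \mapsto f^{-1}$. $\mathcal{I}_1$ is the topology on $I_X$ generated (as a subbasis) by the sets $\{ f \in I_X \mid (x,y) \in f \}$ and $\{ f \in I_X \mid (x,y) \notin f \}$ for $x,y \in X$. $\mathcal{I}_4$ is the topology on $I_X$ generated (as a subbasis) by the sets $\{ f \in I_X \mid (x,y) \in f \}$, $\{ f \in I_X \mid x \notin \operatorname{dom}(f) \}$ and $\{ f \in I_X \mid x \notin \operatorname{im}(f) \}$ for $x,y \in X$. A relational structure $\mathcal{R} = (X,\mathbf{R})$ on $X$ consists of $X$ together with an arbitrary set $\mathbf{R}$ of relations on $X$, each $R \in \mathbf{R}$ being a subset of $X^{n}$ for some natural number $n = \operatorname{dim}(R)$, its arity. For a tuple $\alpha = (a_0,\dots,a_{n-1}) \in \operatorname{dom}(f)^n$, $\alpha f = (a_0 f, \dots, a_{n-1} f)$. The set of partial automorphisms of $\mathcal{R}$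 is $\operatorname{pAut}(\mathcal{R}) = \{ f \in I_X \mid (\forall R \in \mathbf{R})(\forall \alpha \in \operatorname{dom}(f)^{\operatorname{dim}(R)})\ \alpha f \in R \Leftrightarrow \alpha \in R \}$. *)

theory Defs
  imports "HOL-Algebra.Group" "HOL-Analysis.Abstract_Topology"
begin

section \<open>The symmetric inverse monoid\<close>

text \<open>A chart is a partial bijection, identified with its graph. Composition of charts written
  left to right is then relational composition, and the inverse of a chart is its converse.\<close>

definition charts :: "'a set \<Rightarrow> ('a \<times> 'a) set set" where
  "charts X = {f. f \<subseteq> X \<times> X \<and> single_valued f \<and> single_valued (f\<inverse>)}"

definition sym_inv_monoid :: "'a set \<Rightarrow> ('a \<times> 'a) set monoid" where
  "sym_inv_monoid X = \<lparr>carrier = charts X, mult = (O), one = Id_on X\<rparr>"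

lemma sym_inv_monoid_simps [simp]:
  "carrier (sym_inv_monoid X) = charts X"
  "f \<otimes>\<^bsub>sym_inv_monoid X\<^esub> g = f O g"
  "\<one>\<^bsub>sym_inv_monoid X\<^esub> = Id_on X"
  by (simp_all add: sym_inv_monoid_def)

lemma charts_comp: "f \<in> charts X \<Longrightarrow> g \<in> charts X \<Longrightarrow> f O g \<in> charts X"
  by (auto simp: charts_def single_valued_def) blast+

lemma charts_converse: "f \<in> charts X \<Longrightarrow> f\<inverse> \<in> charts X"
  by (auto simp: charts_def)

lemma Id_on_charts: "A \<subseteq> X \<Longrightarrow> Id_on A \<in> charts X"
  by (auto simp: charts_def single_valued_def)

lemma monoid_sym_inv_monoid: "monoid (sym_inv_monoid X)"
  by (rule monoidI) (auto simp: charts_comp Id_on_charts O_assoc, auto simp: charts_def)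

definition idempotents :: "'a set \<Rightarrow> ('a \<times> 'a) set set" where
  "idempotents X = {f \<in> charts X. f \<otimes>\<^bsub>sym_inv_monoid X\<^esub> f = f}"

lemma idempotents_eq_partial_identities: "idempotents X = Id_on ` Pow X"
proof (intro subset_antisym subsetI)
  fix f assume f: "f \<in> idempotents X"
  have "f = Id_on (Domain f)"
  proof -
    have "x = y" if "(x, y) \<in> f" for x y
    proof -
      have "(x, y) \<in> f O f"
        using f that by (simp add: idempotents_def)
      then obtain z where "(x, z) \<in> f" "(z, y) \<in> f"
        by blast
      moreover have "single_valued f" "single_valued (f\<inverse>)"
        using f by (auto simp: idempotents_def charts_def)
      ultimately show "x = y"
        using that by (metis converseI single_valuedD)
    qed
    then show ?thesis
      by (auto simp: Id_on_def)
  qed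
  moreover have "Domain f \<subseteq> X"
    using f by (auto simp: idempotents_def charts_def)
  ultimately show "f \<in> Id_on ` Pow X" by blast
next
  fix f assume "f \<in> Id_on ` Pow X"
  then show "f \<in> idempotents X"
    by (auto simp: idempotents_def Id_on_charts)
qed

definition full_inverse_submonoid :: "('a \<times> 'a) set set \<Rightarrow> 'a set \<Rightarrow> bool" where
  "full_inverse_submonoid M X \<longleftrightarrow>
     submonoid M (sym_inv_monoid X) \<and> idempotents X \<subseteq> M \<and> (\<forall>f\<in>M. f\<inverse> \<in> M)"


section \<open>The topologies\<close>

text \<open>The space of \<^const>\<open>topology_generated_by\<close> is the union of the subbasis, so the whole space
  \<^term>\<open>charts X\<close> (the empty intersection) is inserted explicitly; this only
  matters when \<^term>\<open>X\<close> is empty.\<close>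

definition top_I1 :: "'a set \<Rightarrow> ('a \<times> 'a) set topology" where
  "top_I1 X = topology_generated_by (insert (charts X)
     ({{f \<in> charts X. (x, y) \<in> f} | x y. x \<in> X \<and> y \<in> X} \<union>
      {{f \<in> charts X. (x, y) \<notin> f} | x y. x \<in> X \<and> y \<in> X}))"

definition top_I4 :: "'a set \<Rightarrow> ('a \<times> 'a) set topology" where
  "top_I4 X = topology_generated_by (insert (charts X)
     ({{f \<in> charts X. (x, y) \<in> f} | x y. x \<in> X \<and> y \<in> X} \<union>
      {{f \<in> charts X. x \<notin> Domain f} | x. x \<in> X} \<union>
      {{f \<in> charts X. x \<notin> Range f} | x. x \<in> X}))"

lemma topspace_top_I1 [simp]: "topspace (top_I1 X) = charts X"
  by (auto simp: top_I1_def)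

lemma topspace_top_I4 [simp]: "topspace (top_I4 X) = charts X"
  by (auto simp: top_I4_def)


section \<open>Relational structures and partial automorphisms\<close>

definition tuples :: "'a set \<Rightarrow> nat \<Rightarrow> 'a list set" where
  "tuples A n = {\<alpha>. length \<alpha> = n \<and> set \<alpha> \<subseteq> A}"

text \<open>A relation is a pair of its arity and its graph, so that the empty relation has a
  definite arity, too.\<close>

definition relational_structure :: "'a set \<Rightarrow> (nat \<times> 'a list set) set \<Rightarrow> bool" where
  "relational_structure X \<R> \<longleftrightarrow> (\<forall>(n, R)\<in>\<R>. R \<subseteq> tuples X n)"

definition chart_apply :: "('a \<times> 'a) set \<Rightarrow> 'a \<Rightarrow> 'a" where
  "chart_apply f x = (THE y. (x, y) \<in> f)"

lemma chart_apply_eq: "f \<in> charts X \<Longrightarrow> (x, y) \<in> f \<Longrightarrow> chart_apply f x = y"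
  by (auto simp: chart_apply_def charts_def single_valued_def)

definition pAut :: "'a set \<Rightarrow> (nat \<times> 'a list set) set \<Rightarrow> ('a \<times> 'a) set set" where
  "pAut X \<R> = {f \<in> charts X. \<forall>(n, R)\<in>\<R>. \<forall>\<alpha>\<in>tuples (Domain f) n.
                 map (chart_apply f) \<alpha> \<in> R \<longleftrightarrow> \<alpha> \<in> R}"

end

(* Membership in any of the three kinds of submonoid is decided on finite restrictions. A basic
   I4-neighbourhood of f contains some finite restriction F of f and every chart between F and f,
   so an I4-closed M containing all finite restrictions of f contains f. Such an M is therefore
   recovered from the M-orbits of finite tuples, taken as relations. Conversely, a failure to
   preserve a relation is witnessed by finitely many pairs, hence persists on an
   I1-neighbourhood. *)
theory Submission
  imports Defs
begin

section \<open>Charts acting on points and tuples\<close>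

lemma charts_subset: "f \<in> charts X \<Longrightarrow> g \<subseteq> f \<Longrightarrow> g \<in> charts X"
  unfolding charts_def using single_valued_subset converse_mono by blast

lemma pAut_iff:
  "f \<in> pAut X \<R> \<Longrightarrow> (n, R) \<in> \<R> \<Longrightarrow> \<alpha> \<in> tuples (Domain f) n \<Longrightarrow>
     map (chart_apply f) \<alpha> \<in> R \<longleftrightarrow> \<alpha> \<in> R"
  unfolding pAut_def by blast

lemma chart_graph: "f \<in> charts X \<Longrightarrow> x \<in> Domain f \<Longrightarrow> (x, chart_apply f x) \<in> f"
  using chart_apply_eq by fastforce

text \<open>Each entry x is joined to its final image by a path through its image under
  \<open>f\<close>, which puts the pair in \<open>f O g\<close>. This law of the partial action on
  tuples later makes orbits stable under \<open>M\<close>.\<close>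

lemma map_chart_apply_comp:
  assumes "f \<in> charts X" "g \<in> charts X" "set \<alpha> \<subseteq> Domain f"
    "set (map (chart_apply f) \<alpha>) \<subseteq> Domain g"
  shows "set \<alpha> \<subseteq> Domain (f O g)"
    and "map (chart_apply g) (map (chart_apply f) \<alpha>) = map (chart_apply (f O g)) \<alpha>"
proof -
  have *: "(x, chart_apply g (chart_apply f x)) \<in> f O g" if "x \<in> set \<alpha>" for x
  proof (rule relcompI)
    show "(x, chart_apply f x) \<in> f"
      using assms(3) that by (intro chart_graph[OF assms(1)]) auto
    show "(chart_apply f x, chart_apply g (chart_apply f x)) \<in> g"
      using assms(4) that by (intro chart_graph[OF assms(2)]) auto
  qed
  show "set \<alpha> \<subseteq> Domain (f O g)" using * by blast
  show "map (chart_apply g) (map (chart_apply f) \<alpha>) = map (chart_apply (f O g)) \<alpha>"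
    using chart_apply_eq[OF charts_comp[OF assms(1,2)] *] by simp
qed

lemma map_chart_apply_converse:
  assumes "f \<in> charts X" "set \<alpha> \<subseteq> Domain f"
  shows "set (map (chart_apply f) \<alpha>) \<subseteq> Domain (f\<inverse>)"
    and "map (chart_apply (f\<inverse>)) (map (chart_apply f) \<alpha>) = \<alpha>"
proof -
  have *: "(chart_apply f x, x) \<in> f\<inverse>" if "x \<in> set \<alpha>" for x
    using chart_graph[OF assms(1)] assms(2) that by blast
  show "set (map (chart_apply f) \<alpha>) \<subseteq> Domain (f\<inverse>)" using * by auto
  show "map (chart_apply (f\<inverse>)) (map (chart_apply f) \<alpha>) = \<alpha>"
    using chart_apply_eq[OF charts_converse[OF assms(1)] *] by (simp add: map_idI)
qed

section \<open>Partial automorphisms form an I1-closed set\<close>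

lemma openin_top_I1_mem:
  assumes "x \<in> X" "y \<in> X"
  shows "openin (top_I1 X) {f \<in> charts X. (x, y) \<in> f}"
  unfolding top_I1_def
  by (intro topology_generated_by_Basis insertI2 UnI1) (use assms in blast)

lemma openin_top_I4_mem:
  assumes "x \<in> X" "y \<in> X"
  shows "openin (top_I4 X) {f \<in> charts X. (x, y) \<in> f}"
  unfolding top_I4_def
  by (intro topology_generated_by_Basis insertI2 UnI1) (use assms in blast)

lemma openin_top_I4_not_mem_Domain:
  assumes "x \<in> X"
  shows "openin (top_I4 X) {f \<in> charts X. x \<notin> Domain f}"
  unfolding top_I4_def
  by (intro topology_generated_by_Basis insertI2, rule UnI1, rule UnI2) (use assms in blast)

text \<open>A finite intersection of subbasic sets, one for each pair in \<open>F\<close>; the empty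
  intersection is the whole space. These are the neighbourhoods that separate a chart from
  \<open>pAut\<close>.\<close>

lemma openin_top_I1_superset:
  assumes "finite F" "F \<subseteq> X \<times> X"
  shows "openin (top_I1 X) {g \<in> charts X. F \<subseteq> g}"
  using assms
proof (induction F)
  case empty
  then show ?case using openin_topspace[of "top_I1 X"] by simp
next
  case (insert p F)
  obtain x y where p: "p = (x, y)" by (cases p)
  have "openin (top_I1 X) {f \<in> charts X. (x, y) \<in> f}"
    using insert.prems p by (intro openin_top_I1_mem) auto
  moreover have "openin (top_I1 X) {g \<in> charts X. F \<subseteq> g}"
    using insert by auto
  ultimately have "openin (top_I1 X) ({f \<in> charts X. (x, y) \<in> f} \<inter> {g \<in> charts X. F \<subseteq> g})"
    by (rule openin_Int)
  also have "{f \<in> charts X. (x, y) \<in> f} \<inter> {g \<in> charts X. F \<subseteq> g}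
      = {g \<in> charts X. insert p F \<subseteq> g}"
    by (auto simp: p)
  finally show ?case .
qed

lemma closedin_pAut: "closedin (top_I1 X) (pAut X \<R>)"
proof -
  have "\<exists>U. openin (top_I1 X) U \<and> f \<in> U \<and> U \<subseteq> charts X - pAut X \<R>"
    if f: "f \<in> charts X - pAut X \<R>" for f
  proof -
    obtain n R \<alpha> where R: "(n, R) \<in> \<R>" and \<alpha>: "\<alpha> \<in> tuples (Domain f) n"
      and moved: "(map (chart_apply f) \<alpha> \<in> R) \<noteq> (\<alpha> \<in> R)"
      using f by (auto simp: pAut_def)
    \<comment> \<open>The restriction of \<open>f\<close> to the entries of \<alpha>. Every chart
      containing it sends \<alpha> to the same tuple as \<open>f\<close>, hence fails on
      \<open>R\<close> in the same way.\<close>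
    define F where "F = (\<lambda>x. (x, chart_apply f x)) ` set \<alpha>"
    have Ff: "F \<subseteq> f"
      using \<alpha> f chart_graph by (fastforce simp: F_def tuples_def)
    have "g \<notin> pAut X \<R>" if g: "g \<in> charts X" "F \<subseteq> g" for g
    proof -
      have *: "(x, chart_apply f x) \<in> g" if "x \<in> set \<alpha>" for x
        using g that by (auto simp: F_def)
      then have "map (chart_apply g) \<alpha> = map (chart_apply f) \<alpha>"
        using chart_apply_eq[OF g(1)] by simp
      moreover have "\<alpha> \<in> tuples (Domain g) n"
        using * \<alpha> by (auto simp: tuples_def)
      ultimately show ?thesis
        using moved pAut_iff[OF _ R] by metis
    qed
    moreover have "openin (top_I1 X) {g \<in> charts X. F \<subseteq> g}"
      using Ff f by (intro openin_top_I1_superset) (auto simp: F_def charts_def)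
    ultimately show ?thesis using Ff f by blast
  qed
  then have "openin (top_I1 X) (charts X - pAut X \<R>)"
    by (subst openin_subopen) blast
  then show ?thesis
    by (auto simp: closedin_def pAut_def)
qed

section \<open>The topology I4 refines I1\<close>

lemma openin_top_I4_not_mem:
  assumes "x \<in> X" "y \<in> X"
  shows "openin (top_I4 X) {f \<in> charts X. (x, y) \<notin> f}"
proof -
  \<comment> \<open>By single-valuedness, a chart omits \<open>(x, y)\<close> exactly when it is
    undefined at \<open>x\<close> or sends \<open>x\<close> to some \<open>z\<close> other than
    \<open>y\<close>; both alternatives are I4-open.\<close>
  have "openin (top_I4 X) (\<Union>z\<in>X - {y}. {f \<in> charts X. (x, z) \<in> f})"
    using openin_top_I4_mem[OF assms(1)] by (intro openin_Union) auto
  then have "openin (top_I4 X)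
      ({f \<in> charts X. x \<notin> Domain f} \<union> (\<Union>z\<in>X - {y}. {f \<in> charts X. (x, z) \<in> f}))"
    by (rule openin_Un[OF openin_top_I4_not_mem_Domain[OF assms(1)]])
  also have "{f \<in> charts X. x \<notin> Domain f} \<union> (\<Union>z\<in>X - {y}. {f \<in> charts X. (x, z) \<in> f})
      = {f \<in> charts X. (x, y) \<notin> f}"
    by (auto simp: charts_def single_valued_def)
  finally show ?thesis .
qed

text \<open>The topology generated by a family is the coarsest one in which its members are open, so
  it suffices to check the subbasis of I1.\<close>

lemma openin_top_I1_imp_top_I4:
  assumes "openin (top_I1 X) U"
  shows "openin (top_I4 X) U"
proof -
  let ?B = "insert (charts X)
     ({{f \<in> charts X. (x, y) \<in> f} | x y. x \<in> X \<and> y \<in> X} \<union>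
      {{f \<in> charts X. (x, y) \<notin> f} | x y. x \<in> X \<and> y \<in> X})"
  have whole: "openin (top_I4 X) (charts X)"
    using openin_topspace[of "top_I4 X"] by simp
  have "openin (top_I4 X) S" if S: "S \<in> ?B" for S
  proof -
    consider "S = charts X"
      | x y where "S = {f \<in> charts X. (x, y) \<in> f}" "x \<in> X" "y \<in> X"
      | x y where "S = {f \<in> charts X. (x, y) \<notin> f}" "x \<in> X" "y \<in> X"
      using S by blast
    then show ?thesis
      by cases (simp_all only: whole openin_top_I4_mem openin_top_I4_not_mem)
  qed
  moreover have "generate_topology_on ?B U"
    using assms by (simp only: top_I1_def openin_topology_generated_by_iff)
  ultimately show ?thesis
    by (rule generate_topology_on_coarsest[OF istopology_openin])
qed

lemma closedin_top_I1_imp_top_I4: "closedin (top_I1 X) M \<Longrightarrow> closedin (top_I4 X) M"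
  by (simp add: closedin_def openin_top_I1_imp_top_I4)

section \<open>Finite restrictions and I4-closed sets\<close>

lemma top_I4_neighbourhood:
  assumes "openin (top_I4 X) U" "f \<in> charts X" "f \<in> U"
  shows "\<exists>F. finite F \<and> F \<subseteq> f \<and> (\<forall>g. F \<subseteq> g \<longrightarrow> g \<subseteq> f \<longrightarrow> g \<in> U)"
  using assms(1,3) unfolding top_I4_def openin_topology_generated_by_iff
proof (induction rule: generate_topology_on.induct)
  case Empty
  then show ?case by simp
next
  case (Int a b)
  obtain F where "finite F" "F \<subseteq> f" "\<forall>g. F \<subseteq> g \<longrightarrow> g \<subseteq> f \<longrightarrow> g \<in> a"
    using Int.IH(1)[OF IntD1[OF Int.prems]] by blast
  moreover obtain G where "finite G" "G \<subseteq> f" "\<forall>g. G \<subseteq> g \<longrightarrow> g \<subseteq> f \<longrightarrow> g \<in> b"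
    using Int.IH(2)[OF IntD2[OF Int.prems]] by blast
  ultimately show ?case by (intro exI[of _ "F \<union> G"]) auto
next
  case (UN K)
  then obtain k where k: "k \<in> K" "f \<in> k" by blast
  obtain F where F: "finite F" "F \<subseteq> f" "\<forall>g. F \<subseteq> g \<longrightarrow> g \<subseteq> f \<longrightarrow> g \<in> k"
    using UN.IH[OF k] by (elim exE conjE)
  show ?case
    using F k(1) by (intro exI[of _ F]) auto
next
  \<comment> \<open>Only the condition \<open>(x, y) \<in> f\<close> requires a pair in the finite
    set. Missing a point in the domain or range passes from \<open>f\<close> to its restrictions,
    though not to its extensions; this is why \<open>g\<close> is bounded by
    \<open>f\<close>.\<close>
  case (Basis S)
  have sub: "g \<in> charts X" if "g \<subseteq> f" for g
    using charts_subset[OF assms(2) that] .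
  consider (whole) "S = charts X"
    | (pair) x y where "S = {f \<in> charts X. (x, y) \<in> f}"
    | (dom) x where "S = {f \<in> charts X. x \<notin> Domain f}"
    | (ran) x where "S = {f \<in> charts X. x \<notin> Range f}"
    using Basis.hyps by blast
  then show ?case
  proof cases
    case whole
    then show ?thesis using sub by (intro exI[of _ "{}"]) auto
  next
    case pair
    then show ?thesis using Basis.prems sub by (intro exI[of _ "{(x, y)}"]) auto
  next
    case dom
    then show ?thesis using Basis.prems sub by (intro exI[of _ "{}"]) blast
  next
    case ran
    then show ?thesis using Basis.prems sub by (intro exI[of _ "{}"]) blast
  qed
qed

lemma closedin_top_I4_finitary:
  assumes "closedin (top_I4 X) M" "f \<in> charts X" "\<And>F. finite F \<Longrightarrow> F \<subseteq> f \<Longrightarrow> F \<in> M"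
  shows "f \<in> M"
proof (rule ccontr)
  assume "f \<notin> M"
  then obtain F where "finite F" "F \<subseteq> f" "\<forall>g. F \<subseteq> g \<longrightarrow> g \<subseteq> f \<longrightarrow> g \<in> charts X - M"
    using top_I4_neighbourhood[of X "charts X - M" f] assms(1,2) by (auto simp: closedin_def)
  \<comment> \<open>The choice \<open>g = F\<close> places the finite restriction \<open>F\<close>
    itself outside \<open>M\<close>.\<close>
  then show False using assms(3) by blast
qed

section \<open>Orbits of tuples under a full inverse submonoid\<close>

definition orbit :: "('a \<times> 'a) set set \<Rightarrow> 'a list \<Rightarrow> 'a list set" where
  "orbit M \<alpha> = {map (chart_apply f) \<alpha> | f. f \<in> M \<and> set \<alpha> \<subseteq> Domain f}"

context
  fixes X :: "'a set" and M :: "('a \<times> 'a) set set"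
  assumes full: "full_inverse_submonoid M X"
begin

lemma full_charts: "M \<subseteq> charts X"
  using full submonoid.subset[of M "sym_inv_monoid X"] by (simp add: full_inverse_submonoid_def)

lemma full_comp: "f \<in> M \<Longrightarrow> g \<in> M \<Longrightarrow> f O g \<in> M"
  using full submonoid.m_closed[of M "sym_inv_monoid X"] by (simp add: full_inverse_submonoid_def)

lemma full_converse: "f \<in> M \<Longrightarrow> f\<inverse> \<in> M"
  using full by (auto simp: full_inverse_submonoid_def)

lemma full_Id_on: "A \<subseteq> X \<Longrightarrow> Id_on A \<in> M"
  using full by (auto simp: full_inverse_submonoid_def idempotents_eq_partial_identities)

lemma orbit_step:
  assumes "f \<in> M" "\<beta> \<in> orbit M \<alpha>" "set \<beta> \<subseteq> Domain f"
  shows "map (chart_apply f) \<beta> \<in> orbit M \<alpha>"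
proof -
  obtain g where g: "g \<in> M" "set \<alpha> \<subseteq> Domain g" "\<beta> = map (chart_apply g) \<alpha>"
    using assms(2) by (auto simp: orbit_def)
  show ?thesis
    using map_chart_apply_comp[of g X f \<alpha>] g assms full_charts full_comp[of g f]
    unfolding orbit_def by blast
qed

text \<open>The backward direction applies the converse of \<open>f\<close>, which also lies in
  \<open>M\<close>. The equivalence is the condition in \<open>pAut\<close> for the relation
  \<open>orbit M \<alpha>\<close>.\<close>

lemma orbit_step_iff:
  assumes "f \<in> M" "set \<beta> \<subseteq> Domain f"
  shows "map (chart_apply f) \<beta> \<in> orbit M \<alpha> \<longleftrightarrow> \<beta> \<in> orbit M \<alpha>"
proof
  have f: "f \<in> charts X" using assms full_charts by blast
  show "\<beta> \<in> orbit M \<alpha>" if "map (chart_apply f) \<beta> \<in> orbit M \<alpha>"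
    using orbit_step[OF full_converse[OF assms(1)] that]
      map_chart_apply_converse[OF f assms(2)] by simp
qed (rule orbit_step[OF assms(1) _ assms(2)])

lemma orbit_refl:
  assumes "set \<alpha> \<subseteq> X"
  shows "\<alpha> \<in> orbit M \<alpha>"
proof -
  have "map (chart_apply (Id_on X)) \<alpha> = \<alpha>"
    using assms by (intro map_idI chart_apply_eq[OF Id_on_charts[OF order_refl]]) auto
  then show ?thesis
    using assms full_Id_on[OF order_refl] unfolding orbit_def by force
qed

text \<open>The orbit supplies some \<open>g\<close> in \<open>M\<close> agreeing with
  \<open>f\<close> on the entries of \<alpha>, that is, on the domain of \<open>F\<close>. Hence
  \<open>F\<close> is \<open>g\<close> cut down by a partial identity, and fullness puts that
  identity in \<open>M\<close>.\<close>

lemma orbit_imp_restriction: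
  assumes f: "f \<in> charts X" and F: "F \<subseteq> f" and \<alpha>: "set \<alpha> = Domain F"
    and orb: "map (chart_apply f) \<alpha> \<in> orbit M \<alpha>"
  shows "F \<in> M"
proof -
  obtain g where g: "g \<in> M" "Domain F \<subseteq> Domain g"
    and eq: "\<And>x. x \<in> Domain F \<Longrightarrow> chart_apply f x = chart_apply g x"
    using orb \<alpha> by (auto simp: orbit_def)
  have gX: "g \<in> charts X" using g full_charts by blast
  have "(x, y) \<in> F \<longleftrightarrow> x \<in> Domain F \<and> (x, y) \<in> g" for x y
  proof
    assume xy: "(x, y) \<in> F"
    then have "chart_apply f x = y"
      using chart_apply_eq[OF f] F by blast
    with xy show "x \<in> Domain F \<and> (x, y) \<in> g"
      using chart_graph[OF gX, of x] eq[of x] g(2) by (metis DomainI subsetD)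
  next
    assume xy: "x \<in> Domain F \<and> (x, y) \<in> g"
    then obtain z where z: "(x, z) \<in> F" by blast
    then have "z = y"
      using chart_apply_eq[OF f, of x z] chart_apply_eq[OF gX, of x y] eq[of x] F xy by auto
    with z show "(x, y) \<in> F" by simp
  qed
  then have "F = Id_on (Domain F) O g" by (auto 0 3)
  moreover have "Domain F \<subseteq> X" using f F by (auto simp: charts_def)
  ultimately show ?thesis
    using full_comp[OF full_Id_on g(1)] by metis
qed

text \<open>Arities are unbounded because \<alpha> must be able to list the domain of any finite
  restriction; the empty tuple serves the empty restriction.\<close>

lemma eq_pAut_orbits:
  assumes "closedin (top_I4 X) M"
  shows "M = pAut X {(length \<alpha>, orbit M \<alpha>) | \<alpha>. set \<alpha> \<subseteq> X}"
proof (intro subset_antisym subsetI)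
  fix f assume "f \<in> M"
  then show "f \<in> pAut X {(length \<alpha>, orbit M \<alpha>) | \<alpha>. set \<alpha> \<subseteq> X}"
    using full_charts orbit_step_iff by (auto simp: pAut_def tuples_def)
next
  fix f assume pAut: "f \<in> pAut X {(length \<alpha>, orbit M \<alpha>) | \<alpha>. set \<alpha> \<subseteq> X}"
  then have f: "f \<in> charts X" by (simp add: pAut_def)
  show "f \<in> M"
  proof (rule closedin_top_I4_finitary[OF assms f])
    fix F assume F: "finite F" "F \<subseteq> f"
    then obtain \<alpha> where \<alpha>: "set \<alpha> = Domain F"
      using finite_list[OF finite_Domain] by blast
    then have X: "set \<alpha> \<subseteq> X" and dom: "\<alpha> \<in> tuples (Domain f) (length \<alpha>)"
      using F f by (auto simp: charts_def tuples_def)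
    \<comment> \<open>The tuple \<alpha> belongs to its own orbit, and \<open>f\<close> preserves
      that relation.\<close>
    have "map (chart_apply f) \<alpha> \<in> orbit M \<alpha>"
      using pAut_iff[OF pAut _ dom, of "orbit M \<alpha>"] orbit_refl[OF X] X by blast
    then show "F \<in> M"
      by (rule orbit_imp_restriction[OF f F(2) \<alpha>])
  qed
qed

lemma relational_structure_orbits:
  "relational_structure X {(length \<alpha>, orbit M \<alpha>) | \<alpha>. set \<alpha> \<subseteq> X}"
proof -
  have "chart_apply f x \<in> X" if "f \<in> M" "set \<alpha> \<subseteq> Domain f" "x \<in> set \<alpha>" for f x \<alpha>
  proof -
    have "f \<in> charts X" "x \<in> Domain f" using that full_charts by auto
    then show ?thesis
      using chart_graph[of f X x] by (auto simp: charts_def)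
  qed
  then have "orbit M \<alpha> \<subseteq> tuples X (length \<alpha>)" for \<alpha>
    by (auto simp: tuples_def orbit_def)
  then show ?thesis
    unfolding relational_structure_def by blast
qed

end

theorem theorem4p10:
  fixes X :: "'a set" and M :: "('a \<times> 'a) set set"
  assumes "full_inverse_submonoid M X"
  shows "(closedin (top_I1 X) M \<longleftrightarrow> closedin (top_I4 X) M) \<and>
         (closedin (top_I4 X) M \<longleftrightarrow>
           (\<exists>\<R>. relational_structure X \<R> \<and> M = pAut X \<R>))"
proof -
  \<comment> \<open>The equivalences come from a cycle: a \<open>pAut\<close> is I1-closed, an
    I1-closed set is I4-closed, and an I4-closed \<open>M\<close> is the \<open>pAut\<close> of its
    orbits.\<close>
  have "closedin (top_I1 X) M" if "M = pAut X \<R>" for \<R>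
    unfolding that by (rule closedin_pAut)
  moreover have "\<exists>\<R>. relational_structure X \<R> \<and> M = pAut X \<R>" if "closedin (top_I4 X) M"
    by (rule exI, rule conjI[OF relational_structure_orbits eq_pAut_orbits]) (use assms that in simp_all)
  ultimately show ?thesis
    using closedin_top_I1_imp_top_I4[of X M] by blast
qed

end
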